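(* The following twenty-three functions of the complex variable $p$ are equal to one another in a neighborhood of $p=0$. (Level 2) 1. $\dfrac{1}{(1+20p-48p^2+32p^3-32p^4)^{1/2}}\,f_2\!\left(\dfrac{p(1-p)^3(1-2p)(1+2p)^3}{(1+20p-48p^2+32p^3-32p^4)^2}\right)$ 2. $\dfrac{1}{(1-4p+24p^2-40p^3-8p^4)^{1/2}}\,f_2\!\left(\dfrac{p^2(1-p)^6}{(1-4p+24p^2-40p^3-8p^4)^2}\right)$ 3. $\dfrac{1}{(1-4p+32p^3-32p^4)^{1/2}}\,f_2\!\left(\dfrac{p^3(1-p)(1-2p)^3(1+2p)}{(1-4p+32p^3-32p^4)^2}\right)$ 4. $\dfrac{1}{(1-4p+8p^3-8p^4)^{1/2}}\,f_2\!\left(\dfrac{p^6(1-p)^2}{(1-4p+8p^3-8p^4)^2}\right)$ 5. $\dfrac{1}{(1-28p+96p^2-112p^3+16p^4)^{1/2}}\,f_2\!\left(\dfrac{-p(1-p)^3(1-4p)^3}{(1-28p+96p^2-112p^3+16p^4)^2}\right)$ 6. $\dfrac{1}{(1-4p-16p^3+16p^4)^{1/2}}\,f_2\!\left(\dfrac{-p^3(1-p)(1-4p)}{(1-4p-16p^3+16p^4)^2}\right)$ (Level 3) 7. $\dfrac{1}{1+4p-8p^2}\,f_3\!\left(\dfrac{p(1-2p)}{(1+4p-8p^2)^3}\right)$ 8. $\dfrac{1}{1-2p+4p^2}\,f_3\!\left(\dfrac{p^2(1-2p)^2}{(1-2p+4p^2)^3}\right)$ 9. $\dfrac{1}{1-2p-2p^2}\,f_3\!\left(\dfrac{p^4(1-2p)}{(1-2p-2p^2)^3}\right)$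 10. $\dfrac{1}{1-8p+4p^2}\,f_3\!\left(\dfrac{-p(1-2p)^4}{(1-8p+4p^2)^3}\right)$ (Level 4) 11. $\dfrac{1}{(1-2p)^{1/2}(1+2p)^{3/2}}\,f_4\!\left(\dfrac{p(1-p)^3}{(1-2p)(1+2p)^3}\right)$ 12. $\dfrac{1}{(1-2p)^{3/2}(1+2p)^{1/2}}\,f_4\!\left(\dfrac{p^3(1-p)}{(1-2p)^3(1+2p)}\right)$ 13. $\dfrac{1}{(1-4p)^{3/2}}\,f_4\!\left(\dfrac{-p(1-p)^3}{(1-4p)^3}\right)$ 14. $\dfrac{1}{(1-4p)^{1/2}}\,f_4\!\left(\dfrac{-p^3(1-p)}{1-4p}\right)$ (Level 6) 15. $\dfrac{1}{(1-4p)^2}\,f_{6a}\!\left(\dfrac{p(1-2p)}{(1-4p)^2}\right)$ 16. $\dfrac{1}{(1-4p)(1+2p)}\,f_{6a}\!\left(\dfrac{p^2}{(1-4p)(1+2p)}\right)$ 17. $\dfrac{1}{(1+2p)^2}\,f_{6a}\!\left(\dfrac{-p}{(1+2p)^2}\right)$ 18. $\dfrac{1}{(1-p)(1+2p)}\,f_{6b}\!\left(\dfrac{p(1-2p)}{(1-p)(1+2p)}\right)$ 19. $\dfrac{1}{(1-p)^2}\,f_{6b}\!\left(\dfrac{p^2}{(1-p)^2}\right)$ 20. $\dfrac{1}{(1-p)(1-4p)}\,f_{6b}\!\left(\dfrac{-p}{(1-p)(1-4p)}\right)$ 21. $f_{6c}\bigl(p(1-2p)\bigr)$ 22. $\dfrac{1}{1-2p}\,f_{6c}\!\left(\dfrac{p^2}{1-2p}\right)$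 23. $\dfrac{1}{(1-2p)^2}\,f_{6c}\!\left(\dfrac{-p}{(1-2p)^2}\right)$
   Context: Fractional powers denote the branch equal to $1$ at $p=0$. With $(s)_n=\Gamma(s+n)/\Gamma(s)$ the Pochhammer symbol, define near $x=0$ $$f_2(x)=\sum_{n\ge0}\frac{(\frac14)_n(\frac34)_n}{n!^2}(64x)^n,\quad f_3(x)=\sum_{n\ge0}\frac{(\frac13)_n(\frac23)_n}{n!^2}(27x)^n,\quad f_4(x)=\sum_{n\ge0}\frac{(\frac12)_n^2}{n!^2}(16x)^n,$$ i.e. $f_2(x)={}_2F_1(\frac14,\frac34;1;64x)$, $f_3(x)={}_2F_1(\frac13,\frac23;1;27x)$, $f_4(x)={}_2F_1(\frac12,\frac12;1;16x)$. For given parameters $(\alpha,\beta,\gamma)$ define the sequence $t(n)$ by $t(0)=1$ and, for all integers $n\ge0$, $$(n+1)^2t(n+1)=(\alpha n^2+\alpha n+\beta)t(n)+\gamma n^2t(n-1)$$ (for $n=0$ the last term vanishes), and put $f(x)=\sum_{n\ge0}t(n)x^n$. Then $f_{6a},f_{6b},f_{6c}$ denote $f$ for $(\alpha,\beta,\gamma)=(-17,-6,-72)$, $(10,3,-9)$, $(7,2,8)$ respectively. *)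

theory Defs
  imports "HOL-Analysis.Analysis"
begin

text \<open>
  All functions below are given by power series and are only meaningful inside the disc of
  convergence; outside of it the value of the sum is unspecified.
\<close>

definition f2 :: "complex \<Rightarrow> complex" where
  "f2 x = (\<Sum>n. pochhammer (1/4) n * pochhammer (3/4) n / (fact n)^2 * (64 * x)^n)"

definition f3 :: "complex \<Rightarrow> complex" where
  "f3 x = (\<Sum>n. pochhammer (1/3) n * pochhammer (2/3) n / (fact n)^2 * (27 * x)^n)"

definition f4 :: "complex \<Rightarrow> complex" where
  "f4 x = (\<Sum>n. (pochhammer (1/2) n)^2 / (fact n)^2 * (16 * x)^n)"

text \<open>
  The recurrence \<open>(n+1)\<^sup>2 t(n+1) = (\<alpha> n\<^sup>2 + \<alpha> n + \<beta>) t(n) + \<gamma> n\<^sup>2 t(n-1)\<close>, solved for \<open>t(n+1)\<close>.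
  For \<open>n = 0\<close> the truncated subtraction \<open>n - 1\<close> is harmless, as the last term has the factor \<open>n\<^sup>2 = 0\<close>.
\<close>

fun apery_seq :: "complex \<Rightarrow> complex \<Rightarrow> complex \<Rightarrow> nat \<Rightarrow> complex" where
  "apery_seq \<alpha> \<beta> \<gamma> 0 = 1"
| "apery_seq \<alpha> \<beta> \<gamma> (Suc n) =
     ((\<alpha> * of_nat n ^ 2 + \<alpha> * of_nat n + \<beta>) * apery_seq \<alpha> \<beta> \<gamma> n
        + \<gamma> * of_nat n ^ 2 * apery_seq \<alpha> \<beta> \<gamma> (n - 1)) / (of_nat n + 1) ^ 2"

definition apery_fun :: "complex \<Rightarrow> complex \<Rightarrow> complex \<Rightarrow> complex \<Rightarrow> complex" where
  "apery_fun \<alpha> \<beta> \<gamma> x = (\<Sum>n. apery_seq \<alpha> \<beta> \<gamma> n * x ^ n)"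

definition f6a :: "complex \<Rightarrow> complex" where
  "f6a = apery_fun (-17) (-6) (-72)"

definition f6b :: "complex \<Rightarrow> complex" where
  "f6b = apery_fun 10 3 (-9)"

definition f6c :: "complex \<Rightarrow> complex" where
  "f6c = apery_fun 7 2 8"

end

theory Submission
  imports Defs "HOL-Complex_Analysis.Laurent_Convergence"
begin

text \<open>
  Each of the functions has the form \<open>w(p) f(x(p))\<close>, where \<open>x\<close> and \<open>w\<^sup>2\<close> are rational with
  \<open>x(0) = 0\<close> and \<open>w(0) = 1\<close>, and where \<open>f = \<Sum> t(n) x\<^sup>n\<close> has coefficients that satisfy the recurrence for
  some \<open>(\<alpha>, \<beta>, \<gamma>)\<close>. The hypergeometric series are included: they have \<open>\<gamma> = 0\<close> and
  \<open>(\<alpha>, \<beta>) = (64, 12), (27, 6), (16, 4)\<close>. In terms of \<open>f\<close> the recurrence is the self-adjoint equation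
  \<open>(x (1 - \<alpha> x - \<gamma> x\<^sup>2) f')' = (\<beta> + \<gamma> x) f\<close> (lemma \<open>apery_fps_ode\<close>).

  Substituting \<open>x = x(p)\<close> and multiplying by \<open>w\<close> turns this equation into another self-adjoint one
  (lemma \<open>selfadjoint_pullback\<close>), and the point is that the twenty-three substitutions all lead to the
  same equation \<open>(A y')' = B y\<close> with \<open>A = p (1-p) (1-2p) (1+2p) (1-4p)\<close> and
  \<open>B = 2 (1-4p) (1+4p-8p\<^sup>2)\<close>. For a given substitution this amounts to two identities between
  polynomials in \<open>p\<close> (definition \<open>pulls_back\<close>, lemma \<open>pulls_back_imp_solution\<close>), which are checked by
  expanding them.

  Since \<open>A\<close> has a simple zero at \<open>p = 0\<close>, this point is a regular singular point of the common equation with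
  the double exponent \<open>0\<close>: a second solution involves a logarithm, and a power series solution is
  determined by its constant term (lemma \<open>selfadjoint_solution_eq_0\<close>). All the functions are analytic
  at \<open>0\<close> and have the value \<open>1\<close> there, so they have the same Taylor series.
\<close>

unbundle no vec_syntax

section \<open>Apery-like series\<close>

definition apery_fps :: "complex \<Rightarrow> complex \<Rightarrow> complex \<Rightarrow> complex fps" where
  "apery_fps \<alpha> \<beta> \<gamma> = Abs_fps (apery_seq \<alpha> \<beta> \<gamma>)"

text \<open>
  Any geometric bound gives a positive radius of convergence. This one comes from
  \<open>n\<^sup>2 + n \<le> (n+1)\<^sup>2\<close>, so that in the recurrence for \<open>t(n+1)\<close> the coefficients of \<open>t(n)\<close> and \<open>t(n-1)\<close>
  have norm at most \<open>\<bar>\<alpha>\<bar> + \<bar>\<beta>\<bar>\<close> and \<open>\<bar>\<gamma>\<bar>\<close>.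
\<close>

lemma norm_apery_seq_le: "norm (apery_seq \<alpha> \<beta> \<gamma> n) \<le> (1 + norm \<alpha> + norm \<beta> + norm \<gamma>) ^ n"
proof (induction n rule: less_induct)
  case (less n)
  define C where "C = 1 + norm \<alpha> + norm \<beta> + norm \<gamma>"
  have C: "C \<ge> 1" by (simp add: C_def)
  show ?case
  proof (cases n)
    case 0
    then show ?thesis by simp
  next
    case (Suc k)
    let ?s = "real k + 1"
    have k: "norm (apery_seq \<alpha> \<beta> \<gamma> k) \<le> C ^ k"
      using less[of k] Suc by (simp add: C_def)
    have "norm (apery_seq \<alpha> \<beta> \<gamma> (k - 1)) \<le> C ^ (k - 1)"
      using less[of "k - 1"] Suc by (simp add: C_def)
    also have "\<dots> \<le> C ^ k" using C by (intro power_increasing) auto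
    finally have k1: "norm (apery_seq \<alpha> \<beta> \<gamma> (k - 1)) \<le> C ^ k" .
    have s: "real k ^ 2 \<le> ?s ^ 2" "real k ^ 2 + real k \<le> ?s ^ 2" "1 \<le> ?s ^ 2"
      by (auto simp: power2_eq_square algebra_simps)
    have "norm (\<alpha> * of_nat k ^ 2 + \<alpha> * of_nat k + \<beta>)
        \<le> norm (\<alpha> * of_nat k ^ 2) + norm (\<alpha> * of_nat k) + norm \<beta>"
      by (intro order_trans[OF norm_triangle_ineq] add_mono) auto
    also have "\<dots> = norm \<alpha> * (real k ^ 2 + real k) + norm \<beta> * 1"
      by (simp add: norm_mult norm_power algebra_simps)
    also have "\<dots> \<le> norm \<alpha> * ?s ^ 2 + norm \<beta> * ?s ^ 2"
      using s by (intro add_mono mult_left_mono) auto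
    finally have 1: "norm (\<alpha> * of_nat k ^ 2 + \<alpha> * of_nat k + \<beta>) \<le> (norm \<alpha> + norm \<beta>) * ?s ^ 2"
      by (simp add: algebra_simps)
    have 2: "norm (\<gamma> * of_nat k ^ 2) \<le> norm \<gamma> * ?s ^ 2"
      using s by (simp add: norm_mult norm_power mult_left_mono)
    have "norm ((\<alpha> * of_nat k ^ 2 + \<alpha> * of_nat k + \<beta>) * apery_seq \<alpha> \<beta> \<gamma> k
             + \<gamma> * of_nat k ^ 2 * apery_seq \<alpha> \<beta> \<gamma> (k - 1))
         \<le> ((norm \<alpha> + norm \<beta>) * ?s ^ 2) * C ^ k + (norm \<gamma> * ?s ^ 2) * C ^ k"
      unfolding norm_mult[of _ "apery_seq _ _ _ _"]
      by (intro order_trans[OF norm_triangle_ineq] add_mono, unfold norm_mult[of _ "apery_seq _ _ _ _"])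
         (intro mult_mono 1 2 k k1; simp)+
    also have "\<dots> = (C - 1) * C ^ k * ?s ^ 2" by (simp add: C_def algebra_simps)
    also have "\<dots> \<le> C * C ^ k * ?s ^ 2"
      using C by (intro mult_right_mono) auto
    finally have "norm ((\<alpha> * of_nat k ^ 2 + \<alpha> * of_nat k + \<beta>) * apery_seq \<alpha> \<beta> \<gamma> k
             + \<gamma> * of_nat k ^ 2 * apery_seq \<alpha> \<beta> \<gamma> (k - 1)) \<le> C ^ Suc k * ?s ^ 2" by simp
    moreover have "norm ((of_nat k + 1 :: complex) ^ 2) = ?s ^ 2"
      by (metis norm_of_nat norm_power of_nat_Suc add.commute)
    ultimately show ?thesis
      unfolding Suc C_def[symmetric] by (simp add: norm_divide divide_le_eq del: power_Suc)
  qed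
qed

lemma apery_fun_has_fps_expansion: "apery_fun \<alpha> \<beta> \<gamma> has_fps_expansion apery_fps \<alpha> \<beta> \<gamma>"
proof -
  define C where "C = 1 + norm \<alpha> + norm \<beta> + norm \<gamma>"
  have C: "C > 0" unfolding C_def by (intro add_pos_nonneg) auto
  have "summable (\<lambda>n. apery_seq \<alpha> \<beta> \<gamma> n * (of_real (1 / (2 * C))) ^ n)"
  proof (rule summable_comparison_test)
    show "summable (\<lambda>n. (1/2::real) ^ n)" by (intro summable_geometric) auto
    have "norm (apery_seq \<alpha> \<beta> \<gamma> n * (of_real (1 / (2 * C))) ^ n) \<le> (1/2) ^ n" for n
    proof -
      have "norm (apery_seq \<alpha> \<beta> \<gamma> n * (of_real (1 / (2 * C))) ^ n)
          \<le> C ^ n * (1 / (2 * C)) ^ n"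
        unfolding norm_mult norm_power norm_of_real
        using C norm_apery_seq_le[of \<alpha> \<beta> \<gamma> n, folded C_def] by (intro mult_mono) auto
      also have "\<dots> = (1/2) ^ n"
        unfolding power_mult_distrib[symmetric] using C by (intro arg_cong2[of _ _ _ _ "(^)"]) (auto simp: field_simps)
      finally show ?thesis .
    qed
    then show "\<exists>N. \<forall>n\<ge>N. norm (apery_seq \<alpha> \<beta> \<gamma> n * (of_real (1 / (2 * C))) ^ n) \<le> (1/2) ^ n"
      by blast
  qed
  from conv_radius_geI[OF this] have "conv_radius (apery_seq \<alpha> \<beta> \<gamma>) \<ge> 1 / (2 * C)"
    using C by (simp add: norm_divide norm_mult)
  moreover have "ereal (1 / (2 * C)) > 0" using C by simp
  ultimately have "fps_conv_radius (apery_fps \<alpha> \<beta> \<gamma>) > 0"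
    unfolding fps_conv_radius_def apery_fps_def fps_nth_Abs_fps using less_le_trans by blast
  then show ?thesis
    by (simp add: has_fps_expansion_def eval_fps_def apery_fun_def apery_fps_def)
qed

text \<open>
  The recurrence in self-adjoint form. With \<open>\<theta> = x d/dx\<close> it reads
  \<open>\<theta>\<^sup>2 f = x (\<alpha> \<theta>\<^sup>2 + \<alpha> \<theta> + \<beta>) f + \<gamma> x\<^sup>2 (\<theta> + 1)\<^sup>2 f\<close>, where \<open>\<theta>\<^sup>2 f = x (x f')'\<close>,
  \<open>(\<theta>\<^sup>2 + \<theta>) f = (x\<^sup>2 f')'\<close> and \<open>x (\<theta> + 1)\<^sup>2 f = (x\<^sup>3 f')' + x f\<close>.
\<close>

lemma apery_fps_ode:
  "fps_deriv (fps_X * (1 - fps_const \<alpha> * fps_X - fps_const \<gamma> * fps_X ^ 2) * fps_deriv (apery_fps \<alpha> \<beta> \<gamma>))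
    = (fps_const \<beta> + fps_const \<gamma> * fps_X) * apery_fps \<alpha> \<beta> \<gamma>" (is "?l = ?r")
proof (rule fps_ext)
  fix n
  let ?t = "apery_seq \<alpha> \<beta> \<gamma>"
  have l: "fps_X * (1 - fps_const \<alpha> * fps_X - fps_const \<gamma> * fps_X ^ 2) * f
     = fps_X * f - fps_const \<alpha> * (fps_X * (fps_X * f)) - fps_const \<gamma> * (fps_X * (fps_X * (fps_X * f)))" 
    for f by (simp add: algebra_simps power2_eq_square)
  have nz: "(of_nat n + 1 :: complex) \<noteq> 0" by (metis of_nat_Suc add.commute of_nat_neq_0)
  have "?l $ n = (of_nat n + 1) ^ 2 * ?t (Suc n) - \<alpha> * of_nat n * (of_nat n + 1) * ?t n
       - \<gamma> * (of_nat n + 1) * (of_nat n - 1) * (if n = 0 then 0 else ?t (n - 1))"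
    by (cases n; cases "n - 1")
       (simp_all add: l apery_fps_def algebra_simps power2_eq_square del: apery_seq.simps(2))
  also have "(of_nat n + 1) ^ 2 * ?t (Suc n) = (\<alpha> * of_nat n ^ 2 + \<alpha> * of_nat n + \<beta>) * ?t n
       + \<gamma> * of_nat n ^ 2 * (if n = 0 then 0 else ?t (n - 1))"
    using nz by simp
  also have "\<dots> - \<alpha> * of_nat n * (of_nat n + 1) * ?t n
       - \<gamma> * (of_nat n + 1) * (of_nat n - 1) * (if n = 0 then 0 else ?t (n - 1))
     = \<beta> * ?t n + \<gamma> * (if n = 0 then 0 else ?t (n - 1))"
    by (simp add: algebra_simps power2_eq_square)
  also have "\<dots> = ?r $ n"
    by (simp add: apery_fps_def algebra_simps)
  finally show "?l $ n = ?r $ n" .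
qed

text \<open>
  For \<open>\<gamma> = 0\<close> the recurrence has two terms, and a series with a closed form is recognised by the ratio
  of its consecutive coefficients.
\<close>

lemma apery_seq_eqI:
  assumes "s 0 = 1"
    and "\<And>n. of_nat (Suc n) ^ 2 * s (Suc n) = (\<alpha> * of_nat n ^ 2 + \<alpha> * of_nat n + \<beta>) * s n"
  shows "s n = apery_seq \<alpha> \<beta> 0 n"
proof (induction n)
  case (Suc n)
  have nz: "(of_nat n + 1 :: complex) ^ 2 \<noteq> 0"
    by (metis of_nat_Suc add.commute of_nat_neq_0 power_not_zero)
  with Suc assms(2)[of n] show ?case by (simp add: eq_divide_eq add.commute mult.commute)
qed (simp add: assms)

lemma f2_eq: "f2 = apery_fun 64 12 0"
proof -
  have "pochhammer (1/4 :: complex) n * pochhammer (3/4) n / (fact n)^2 * 64 ^ n = apery_seq 64 12 0 n" for n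
  proof (rule apery_seq_eqI)
    fix n
    show "(of_nat (Suc n) :: complex) ^ 2 * (pochhammer (1/4) (Suc n) * pochhammer (3/4) (Suc n) / (fact (Suc n))^2 * 64 ^ Suc n)
        = (64 * of_nat n ^ 2 + 64 * of_nat n + 12) * (pochhammer (1/4) n * pochhammer (3/4) n / (fact n)^2 * 64 ^ n)"
      unfolding fact_Suc power_mult_distrib
      by (simp add: pochhammer_Suc field_simps power2_eq_square del: of_nat_Suc)
  qed simp
  then show ?thesis
    by (simp add: fun_eq_iff f2_def apery_fun_def power_mult_distrib mult.assoc[symmetric])
qed

lemma f3_eq: "f3 = apery_fun 27 6 0"
proof -
  have "pochhammer (1/3 :: complex) n * pochhammer (2/3) n / (fact n)^2 * 27 ^ n = apery_seq 27 6 0 n" for n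
  proof (rule apery_seq_eqI)
    fix n
    show "(of_nat (Suc n) :: complex) ^ 2 * (pochhammer (1/3) (Suc n) * pochhammer (2/3) (Suc n) / (fact (Suc n))^2 * 27 ^ Suc n)
        = (27 * of_nat n ^ 2 + 27 * of_nat n + 6) * (pochhammer (1/3) n * pochhammer (2/3) n / (fact n)^2 * 27 ^ n)"
      unfolding fact_Suc power_mult_distrib
      by (simp add: pochhammer_Suc field_simps power2_eq_square del: of_nat_Suc)
  qed simp
  then show ?thesis
    by (simp add: fun_eq_iff f3_def apery_fun_def power_mult_distrib mult.assoc[symmetric])
qed

lemma f4_eq: "f4 = apery_fun 16 4 0"
proof -
  have "(pochhammer (1/2 :: complex) n)^2 / (fact n)^2 * 16 ^ n = apery_seq 16 4 0 n" for n
  proof (rule apery_seq_eqI)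
    fix n
    show "(of_nat (Suc n) :: complex) ^ 2 * ((pochhammer (1/2) (Suc n))^2 / (fact (Suc n))^2 * 16 ^ Suc n)
        = (16 * of_nat n ^ 2 + 16 * of_nat n + 4) * ((pochhammer (1/2) n)^2 / (fact n)^2 * 16 ^ n)"
      unfolding fact_Suc power_mult_distrib
      by (simp add: pochhammer_Suc field_simps power2_eq_square del: of_nat_Suc)
  qed simp
  then show ?thesis
    by (simp add: fun_eq_iff f4_def apery_fun_def power_mult_distrib mult.assoc[symmetric])
qed

section \<open>Self-adjoint equations\<close>

text \<open>
  If \<open>y\<close> starts with \<open>y\<^sub>n x\<^sup>n\<close>, \<open>n > 0\<close>, then \<open>A y'\<close> starts with \<open>n A\<^sub>1 y\<^sub>n x\<^sup>n\<close>, and its derivative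
  has order \<open>n - 1\<close>, whereas \<open>B y\<close> has order at least \<open>n\<close>.
\<close>

lemma selfadjoint_solution_eq_0:
  fixes A B y :: "'a :: field_char_0 fps"
  assumes A: "A $ 0 = 0" "A $ 1 \<noteq> 0"
    and ode: "fps_deriv (A * fps_deriv y) = B * y" and y: "y $ 0 = 0"
  shows "y = 0"
proof (rule fps_ext)
  fix n show "y $ n = 0 $ n"
  proof (induction n rule: less_induct)
    case (less n)
    show ?case
    proof (cases n)
      case 0 then show ?thesis using y by simp
    next
      case (Suc m)
      have "(B * y) $ m = 0"
        unfolding fps_mult_nth using less Suc by (intro sum.neutral) auto
      then have "(A * fps_deriv y) $ Suc m = 0"
        unfolding ode[symmetric] fps_deriv_nth by (simp flip: of_nat_Suc del: of_nat_Suc of_nat_add)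
      also have "(A * fps_deriv y) $ Suc m = (\<Sum>i\<in>{0..Suc m}. if i = 1 then A $ 1 * of_nat n * y $ n else 0)"
        unfolding fps_mult_nth
      proof (intro sum.cong refl)
        fix i assume "i \<in> {0..Suc m}"
        then consider "i = 0" | "i = 1" | "i > 1" "i \<le> Suc m" by fastforce
        then show "A $ i * fps_deriv y $ (Suc m - i) = (if i = 1 then A $ 1 * of_nat n * y $ n else 0)"
        proof cases
          case 3
          then have "y $ (Suc m - i + 1) = 0" using less Suc by simp
          then show ?thesis using 3 by simp
        qed (use A Suc in auto)
      qed
      finally show ?thesis using A Suc by (auto split: if_splits simp del: of_nat_Suc)
    qed
  qed
qed

text \<open>
  How \<open>(P f')' = Q f\<close> transforms under \<open>y = w (f \<circ> x)\<close> with \<open>w = V\<^sup>-\<^sup>1\<^sup>/\<^sup>2\<close>. In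
  \<open>A y' = A w' (f \<circ> x) + A w x' (f' \<circ> x)\<close> the first condition turns the last term into
  \<open>r w\<^sup>-\<^sup>1 (P f') \<circ> x\<close>. Differentiating, the equation for \<open>f\<close> applies to this term and the contributions of
  \<open>f' \<circ> x\<close> cancel, which leaves \<open>((A w')' + r w\<^sup>-\<^sup>1 (Q \<circ> x) x') (f \<circ> x)\<close>. The second condition
  says that the bracket is \<open>B w\<close>, after \<open>w' = - w V' / (2 V)\<close> has been used to eliminate \<open>w\<close>.
\<close>

lemma selfadjoint_pullback:
  fixes A B P Q V f w x :: "'a :: field_char_0 fps" and r :: nat
  assumes x: "x $ 0 = 0" and w: "w ^ 2 * V = 1"
    and f: "fps_deriv (P * fps_deriv f) = Q * f"
    and 1: "A * fps_deriv x = of_nat r * (P oo x) * V"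
    and 2: "- 2 * fps_deriv (A * fps_deriv V) * V + 3 * A * fps_deriv V ^ 2
             + 4 * of_nat r * V ^ 3 * fps_deriv x * (Q oo x) = 4 * B * V ^ 2"
  shows "fps_deriv (A * fps_deriv (w * (f oo x))) = B * (w * (f oo x))"
proof -
  define G H E R where "G = f oo x" and "H = fps_deriv f oo x" and "E = P oo x" and "R = Q oo x"
  \<comment> \<open>\<open>u = 1/w\<close>\<close>
  define u where "u = w * V"
  have wu: "w * u = 1" using w by (simp add: u_def power2_eq_square mult.assoc)
  have w0: "w \<noteq> 0" and V0: "V \<noteq> 0" using w by auto
  have G': "fps_deriv G = H * fps_deriv x"
    unfolding G_def H_def by (rule fps_compose_deriv[OF x])
  have "fps_deriv (E * H) = fps_deriv ((P * fps_deriv f) oo x)"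
    by (simp add: E_def H_def fps_compose_mult_distrib[OF x])
  also have "\<dots> = ((Q * f) oo x) * fps_deriv x"
    unfolding fps_compose_deriv[OF x] f ..
  also have "\<dots> = R * G * fps_deriv x"
    by (simp add: R_def G_def fps_compose_mult_distrib[OF x])
  finally have EH: "fps_deriv (E * H) = R * G * fps_deriv x" .
  have "fps_deriv (w ^ 2 * V) = 0" by (simp add: w)
  then have "w * (2 * fps_deriv w * V + w * fps_deriv V) = 0"
    by (simp add: power2_eq_square algebra_simps)
  then have w': "2 * fps_deriv w * V = - (w * fps_deriv V)"
    using w0 by (simp add: eq_neg_iff_add_eq_0)
  have u': "2 * fps_deriv u = w * fps_deriv V"
    using w' by (simp add: u_def algebra_simps)
  have Aw': "2 * A * fps_deriv w * V = - (A * fps_deriv V) * w"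
    using w' by (simp add: algebra_simps)
  (* Differentiate 2 V A w' = - A V' w to obtain (A w')'. *)
  have "fps_deriv (2 * (A * fps_deriv w) * V) = fps_deriv (- ((A * fps_deriv V) * w))"
    using Aw' by (simp add: mult.assoc)
  then have "2 * fps_deriv (A * fps_deriv w) * V + 2 * A * fps_deriv w * fps_deriv V
     = - (fps_deriv (A * fps_deriv V) * w) - A * fps_deriv V * fps_deriv w"
    unfolding fps_deriv_neg fps_deriv_mult[of _ w] fps_deriv_mult[of _ V] fps_deriv_mult[of 2]
    by (simp add: algebra_simps)
  then have "4 * V ^ 2 * fps_deriv (A * fps_deriv w)
     = w * (- 2 * fps_deriv (A * fps_deriv V) * V + 3 * A * fps_deriv V ^ 2)"
    using w' by algebra
  then have "4 * V ^ 2 * (fps_deriv (A * fps_deriv w) + of_nat r * u * R * fps_deriv x - B * w) = 0"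
    using 2 unfolding u_def R_def by algebra
  then have coeff_G: "fps_deriv (A * fps_deriv w) + of_nat r * u * R * fps_deriv x = B * w"
    using V0 by simp
  have "2 * V * (A * fps_deriv w * fps_deriv x + of_nat r * fps_deriv u * E) = 0"
    using w' u' 1 unfolding E_def by algebra
  then have coeff_H: "A * fps_deriv w * fps_deriv x + of_nat r * fps_deriv u * E = 0"
    using V0 by simp
  have "A * fps_deriv (w * G) = (A * fps_deriv w) * G + of_nat r * u * (E * H)"
    unfolding fps_deriv_mult G' u_def using 1 unfolding E_def by algebra
  then have "fps_deriv (A * fps_deriv (w * G)) = fps_deriv ((A * fps_deriv w) * G + (of_nat r * u) * (E * H))"
    by simp
  also have "\<dots> = B * (w * G)"
    unfolding fps_deriv_add fps_deriv_mult[of _ G] fps_deriv_mult[of _ "E * H"] EH G'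
      fps_deriv_mult[of _ u] fps_deriv_of_nat
    using coeff_G coeff_H by algebra
  finally show ?thesis by (simp add: G_def)
qed

section \<open>The common equation of the pullbacks\<close>

text \<open>
  For \<open>w = 1\<close> and \<open>r = 1\<close> the conditions of \<open>selfadjoint_pullback\<close> say that \<open>A = (P \<circ> x) / x'\<close> and
  \<open>B = (Q \<circ> x) x'\<close>. The substitution \<open>x = p (1-2p)\<close> in the equation for \<open>(7, 2, 8)\<close> gives the following
  \<open>A\<close> and \<open>B\<close>.
\<close>

definition ode_A :: "complex poly" where
  "ode_A = [:0, 1:] * [:1, -1:] * [:1, -2:] * [:1, 2:] * [:1, -4:]"

definition ode_B :: "complex poly" where
  "ode_B = [:2, 8, -16:] * [:1, -4:]"

text \<open>
  The conditions of \<open>selfadjoint_pullback\<close> for \<open>x = N / D\<^sup>k\<close> and \<open>V = D\<^sup>m\<close>, that is, \<open>w = D\<^sup>-\<^sup>m\<^sup>/\<^sup>2\<close>, with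
  the denominators cleared; \<open>W\<close> is \<open>D\<^sup>k\<^sup>+\<^sup>1 x'\<close>. The factor \<open>r\<close> has to be the order of vanishing of \<open>N\<close> at
  \<open>0\<close>: near \<open>0\<close> both \<open>A\<close> and \<open>x (1 - \<alpha> x - \<gamma> x\<^sup>2)\<close> agree with their argument to first order, and
  \<open>p x' \<sim> r x\<close>.
\<close>

definition pulls_back :: "nat \<Rightarrow> nat \<Rightarrow> nat \<Rightarrow> complex \<Rightarrow> complex \<Rightarrow> complex \<Rightarrow> complex poly \<Rightarrow> complex poly \<Rightarrow> bool" where
  "pulls_back k m r \<alpha> \<beta> \<gamma> N D \<longleftrightarrow>
     (let W = pderiv N * D - of_nat k * N * pderiv D in
       ode_A * W * D ^ (2 * k)
         = of_nat r * N * (D ^ (2 * k) - [:\<alpha>:] * N * D ^ k - [:\<gamma>:] * N ^ 2) * D ^ (m + 1) \<and>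
       D ^ (2 * k) * ((of_nat m ^ 2 + 2 * of_nat m) * ode_A * pderiv D ^ 2
           - 2 * of_nat m * pderiv (ode_A * pderiv D) * D)
         + 4 * of_nat r * D ^ (m + 1) * W * ([:\<beta>:] * D ^ k + [:\<gamma>:] * N)
         = 4 * ode_B * D ^ (2 * k + 2))"

lemma pulls_back_imp_solution:
  fixes k m r \<alpha> \<beta> \<gamma> N D and w x :: "complex fps"
  assumes pb: "pulls_back k m r \<alpha> \<beta> \<gamma> N D"
    and x0: "x $ 0 = 0" and D0: "D \<noteq> 0"
    and x: "x * fps_of_poly D ^ k = fps_of_poly N"
    and w: "w ^ 2 * fps_of_poly D ^ m = 1"
  defines "y \<equiv> w * (apery_fps \<alpha> \<beta> \<gamma> oo x)"
  shows "fps_deriv (fps_of_poly ode_A * fps_deriv y) = fps_of_poly ode_B * y"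
proof -
  define A B n d where "A = fps_of_poly ode_A" and "B = fps_of_poly ode_B"
    and "n = fps_of_poly N" and "d = fps_of_poly D"
  define W where "W = fps_deriv n * d - of_nat k * n * fps_deriv d"
  define V where "V = d ^ m"
  let ?a = "fps_const \<alpha>" and ?b = "fps_const \<beta>" and ?c = "fps_const \<gamma>"
  have d0: "d \<noteq> 0" using D0 by (simp add: d_def)
  have of_nat': "fps_of_poly (of_nat j) = (of_nat j :: complex fps)" for j
    by (induction j) (simp_all add: fps_of_poly_add)
  note transfer = fps_of_poly_mult fps_of_poly_diff fps_of_poly_add fps_of_poly_power
    fps_of_poly_pderiv fps_of_poly_const of_nat' fps_of_poly_numeral
  have xd: "x * d ^ k = n" using x by (simp add: n_def d_def)
  from pb have C1: "A * W * d ^ (2 * k)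
      = of_nat r * n * (d ^ (2 * k) - ?a * n * d ^ k - ?c * n ^ 2) * d ^ (m + 1)"
    unfolding pulls_back_def Let_def A_def W_def n_def d_def transfer[symmetric]
    by (simp only: fps_of_poly_eq_iff)
  from pb have C2: "d ^ (2 * k) * ((of_nat m ^ 2 + 2 * of_nat m) * A * fps_deriv d ^ 2
           - 2 * of_nat m * fps_deriv (A * fps_deriv d) * d)
         + 4 * of_nat r * d ^ (m + 1) * W * (?b * d ^ k + ?c * n)
         = 4 * B * d ^ (2 * k + 2)"
    unfolding pulls_back_def Let_def A_def B_def W_def n_def d_def transfer[symmetric]
    by (simp only: fps_of_poly_eq_iff)
  have power_deriv: "fps_deriv (d ^ j) * d = of_nat j * d ^ j * fps_deriv d" for j
    unfolding fps_deriv_power' by (cases j) (simp_all add: mult_ac del: of_nat_Suc)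
  have x': "fps_deriv x * d ^ (k + 1) = W"
  proof -
    define e where "e = d ^ k"
    have xe: "x * e = n" and e': "fps_deriv e * d = of_nat k * e * fps_deriv d"
      unfolding e_def by (fact xd, fact power_deriv)
    have "fps_deriv n = x * fps_deriv e + fps_deriv x * e"
      unfolding xe[symmetric] by (rule fps_deriv_mult)
    then show ?thesis
      unfolding W_def power_add power_one_right e_def[symmetric] using xe e' by algebra
  qed
  let ?P = "fps_X * (1 - ?a * fps_X - ?c * fps_X ^ 2)" and ?Q = "?b + ?c * fps_X"
  have P: "?P oo x = x * (1 - ?a * x - ?c * x ^ 2)" and Q: "?Q oo x = ?b + ?c * x"
    by (simp_all add: fps_compose_mult_distrib[OF x0] fps_compose_sub_distrib
        fps_compose_add_distrib fps_compose_power[OF x0, symmetric] x0)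
  (* The conditions of the pullback lemma involve x = n / d^k, so powers of d are multiplied in and
     cancelled at the end. *)
  have 1: "A * fps_deriv x = of_nat r * (?P oo x) * V"
  proof -
    have "d ^ (3 * k + 1) * (A * fps_deriv x) = A * (fps_deriv x * d ^ (k + 1)) * d ^ (2 * k)"
      by (simp add: power_add[symmetric] algebra_simps)
    also have "\<dots> = of_nat r * n * (d ^ (2 * k) - ?a * n * d ^ k - ?c * n ^ 2) * d ^ (m + 1)"
      unfolding x' C1 ..
    also have "\<dots> = d ^ (3 * k + 1) * (of_nat r * (?P oo x) * V)"
      unfolding P V_def xd[symmetric] mult.commute[of 2 k] mult.commute[of 3 k] power_add power_mult
      by algebra
    finally show ?thesis using d0 by simp
  qed
  have V': "fps_deriv V * d = of_nat m * V * fps_deriv d"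
    unfolding V_def by (rule power_deriv)
  have Vd: "d ^ (m + 1) = V * d"
    by (simp add: V_def)
  have "fps_deriv (A * (fps_deriv V * d)) = fps_deriv (of_nat m * V * (A * fps_deriv d))"
    unfolding V' by (simp add: algebra_simps)
  then have AV': "fps_deriv (A * fps_deriv V) * d + A * fps_deriv V * fps_deriv d
    = of_nat m * (fps_deriv V * (A * fps_deriv d) + V * fps_deriv (A * fps_deriv d))"
    unfolding mult.assoc[symmetric, of A _ d] fps_deriv_mult[of _ d] fps_deriv_mult[of _ "A * fps_deriv d"]
      fps_deriv_mult[of _ V] fps_deriv_of_nat by (simp add: algebra_simps)
  define z where "z = fps_deriv (A * fps_deriv d)"
  have "d ^ (2 * k + 2) * (- 2 * fps_deriv (A * fps_deriv V) * V + 3 * A * fps_deriv V ^ 2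
             + 4 * of_nat r * V ^ 3 * fps_deriv x * (?Q oo x))
       = d ^ (2 * k) * (- 2 * (fps_deriv (A * fps_deriv V) * d ^ 2) * V + 3 * A * (fps_deriv V * d) ^ 2)
          + 4 * of_nat r * V ^ 3 * d * (fps_deriv x * d ^ (k + 1)) * ((?Q oo x) * d ^ k)"
    unfolding mult.commute[of 2 k] power_add power_mult by algebra
  also have "(?Q oo x) * d ^ k = ?b * d ^ k + ?c * n"
    unfolding Q xd[symmetric] by algebra
  (* As V is a power of d, V' d and (A V')' d^2 are multiples of V, so that V cancels as well. *)
  also have "fps_deriv (A * fps_deriv V) * d ^ 2
      = V * (of_nat m * z * d + (of_nat m ^ 2 - of_nat m) * A * fps_deriv d ^ 2)"
    using AV' V' unfolding z_def[symmetric] by algebra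
  also have "d ^ (2 * k) * (- 2 * (V * (of_nat m * z * d + (of_nat m ^ 2 - of_nat m) * A * fps_deriv d ^ 2)) * V
               + 3 * A * (fps_deriv V * d) ^ 2)
          + 4 * of_nat r * V ^ 3 * d * (fps_deriv x * d ^ (k + 1)) * (?b * d ^ k + ?c * n)
       = V ^ 2 * (d ^ (2 * k) * ((of_nat m ^ 2 + 2 * of_nat m) * A * fps_deriv d ^ 2 - 2 * of_nat m * z * d)
         + 4 * of_nat r * d ^ (m + 1) * W * (?b * d ^ k + ?c * n))"
    unfolding V' x' Vd by algebra
  also have "\<dots> = d ^ (2 * k + 2) * (4 * B * V ^ 2)"
    unfolding z_def C2 by algebra
  finally have 2: "- 2 * fps_deriv (A * fps_deriv V) * V + 3 * A * fps_deriv V ^ 2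
             + 4 * of_nat r * V ^ 3 * fps_deriv x * (?Q oo x) = 4 * B * V ^ 2"
    using d0 by simp
  show ?thesis
    unfolding y_def A_def[symmetric] B_def[symmetric]
    by (rule selfadjoint_pullback[OF x0 _ apery_fps_ode 1 2]) (use w in \<open>simp add: V_def d_def\<close>)
qed

text \<open>The Taylor series of \<open>f\<^sub>6\<^sub>c(p (1-2p))\<close>, the function with the simplest pullback.\<close>

definition common_fps :: "complex fps" where
  "common_fps = apery_fps 7 2 8 oo fps_of_poly [:0, 1, -2:]"

lemma ode_A_nth: "fps_of_poly ode_A $ 0 = 0" "fps_of_poly ode_A $ 1 \<noteq> 0"
  by (simp_all add: ode_A_def)

lemmas pulls_back_eval = pulls_back_def ode_A_def ode_B_def pderiv_pCons eval_nat_numeral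
  numeral_poly of_nat_poly

lemma common_fps_solution:
  "fps_deriv (fps_of_poly ode_A * fps_deriv common_fps) = fps_of_poly ode_B * common_fps"
proof -
  have "pulls_back 1 2 1 7 2 8 [:0, 1, -2:] [:1:]"
    by (simp add: pulls_back_eval)
  from pulls_back_imp_solution[OF this, where x = "fps_of_poly [:0, 1, -2:]" and w = 1]
  show ?thesis by (simp add: common_fps_def)
qed

lemma fps_eq_common_fps:
  assumes "fps_deriv (fps_of_poly ode_A * fps_deriv y) = fps_of_poly ode_B * y" "y $ 0 = 1"
  shows "y = common_fps"
proof -
  have "y - common_fps = 0"
    by (rule selfadjoint_solution_eq_0[OF ode_A_nth])
       (simp_all only: assms common_fps_solution fps_deriv_sub right_diff_distrib,
        simp add: assms common_fps_def apery_fps_def)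
  then show ?thesis by simp
qed

section \<open>Pullbacks as analytic functions\<close>

lemma poly_has_fps_expansion: "poly q has_fps_expansion fps_of_poly q" for q :: "complex poly"
  by (simp add: has_fps_expansion_def)

lemmas poly_analytic = has_fps_expansion_imp_analytic_0[OF poly_has_fps_expansion]

text \<open>
  Formal solutions become functions near \<open>0\<close>. The square root \<open>\<omega>\<close> of \<open>D\<^sup>m\<close> is left abstract, because the
  functions use products of fractional powers of different factors of \<open>D\<close>; being analytic at \<open>0\<close> with
  value \<open>1\<close> fixes the branch.
\<close>

lemma pullback_has_fps_expansion:
  fixes \<omega> :: "complex \<Rightarrow> complex"
  assumes pb: "pulls_back k m r \<alpha> \<beta> \<gamma> N D" and N: "coeff N 0 = 0" and D: "coeff D 0 = 1"
    and \<omega>: "\<omega> analytic_on {0}" "\<omega> 0 = 1" "\<And>p. \<omega> p ^ 2 = poly D p ^ m"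
  shows "(\<lambda>p. 1 / \<omega> p * apery_fun \<alpha> \<beta> \<gamma> (poly N p / poly D p ^ k)) has_fps_expansion common_fps"
proof -
  define u where "u = fps_expansion \<omega> 0"
  define x where "x = fps_of_poly N * inverse (fps_of_poly D ^ k)"
  have u: "\<omega> has_fps_expansion u"
    unfolding u_def by (rule analytic_at_imp_has_fps_expansion_0[OF \<omega>(1)])
  have u0: "u $ 0 = 1"
    using fps_nth_fps_expansion[OF u, of 0] \<omega>(2) by simp
  have "(\<lambda>p. \<omega> p ^ 2) has_fps_expansion u ^ 2"
    by (intro fps_expansion_intros u)
  moreover have "(\<lambda>p. poly D p ^ m) has_fps_expansion fps_of_poly D ^ m"
    by (intro fps_expansion_intros poly_has_fps_expansion)
  ultimately have u2: "u ^ 2 = fps_of_poly D ^ m"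
    unfolding \<omega>(3) by (rule fps_expansion_unique_complex)
  have wu: "inverse u * u = 1"
    by (rule inverse_mult_eq_1) (simp add: u0)
  have w: "inverse u ^ 2 * fps_of_poly D ^ m = 1"
    unfolding u2[symmetric] power_mult_distrib[symmetric] wu by simp
  have Dk: "(fps_of_poly D ^ k) $ 0 = 1"
    using D by (simp add: fps_power_zeroth)
  have x: "x * fps_of_poly D ^ k = fps_of_poly N"
    using inverse_mult_eq_1[of "fps_of_poly D ^ k"] Dk by (simp add: x_def mult.assoc)
  have x0: "x $ 0 = 0" using N by (simp add: x_def)
  have D0: "D \<noteq> 0" using D by auto
  have "inverse u * (apery_fps \<alpha> \<beta> \<gamma> oo x) = common_fps"
    using pulls_back_imp_solution[OF pb x0 D0 x w]
    by (rule fps_eq_common_fps) (simp add: u0 apery_fps_def)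
  moreover have "(\<lambda>p. poly N p * inverse (poly D p ^ k)) has_fps_expansion x"
    unfolding x_def by (intro fps_expansion_intros poly_has_fps_expansion) (simp add: Dk)
  then have "(\<lambda>p. inverse (\<omega> p) * (apery_fun \<alpha> \<beta> \<gamma> \<circ> (\<lambda>p. poly N p * inverse (poly D p ^ k))) p)
      has_fps_expansion inverse u * (apery_fps \<alpha> \<beta> \<gamma> oo x)"
    by (intro fps_expansion_intros u apery_fun_has_fps_expansion x0) (simp add: u0)
  ultimately show ?thesis by (simp add: field_simps)
qed

section \<open>The substitutions of each level\<close>

lemma powr_half_integer_sq:
  fixes z :: complex
  shows "(z powr (1/2)) ^ 2 = z" "(z powr (3/2)) ^ 2 = z ^ 3"
  by (cases "z = 0"; simp add: power2_eq_square powr_add[symmetric] powr_numeral)+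

text \<open>
  The shapes of the functions. In level 2 the substitution is \<open>N / D\<^sup>2\<close> with factor \<open>D\<^sup>-\<^sup>1\<^sup>/\<^sup>2\<close>, in
  level 3 \<open>N / D\<^sup>3\<close> with \<open>D\<^sup>-\<^sup>1\<close>, in level 4 \<open>N / D\<close> with \<open>D\<^sup>-\<^sup>1\<^sup>/\<^sup>2\<close>, in level 6 \<open>N / D\<close> with \<open>D\<^sup>-\<^sup>1\<close>.
  The functions \<open>n\<close> and \<open>d\<close> are \<open>N\<close> and \<open>D\<close> in whatever notation is convenient for them.
\<close>

lemma level2_expansion:
  assumes "pulls_back 2 1 r 64 12 0 N D" "coeff N 0 = 0" "coeff D 0 = 1"
    and "\<And>p. poly N p = n p" "\<And>p. poly D p = d p"
  shows "(\<lambda>p. 1 / d p powr (1/2) * f2 (n p / d p ^ 2)) has_fps_expansion common_fps"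
  unfolding assms(4,5)[symmetric] f2_eq
  by (rule pullback_has_fps_expansion[OF assms(1-3)])
     (use assms(3) in \<open>auto intro!: analytic_intros poly_analytic simp: powr_half_integer_sq poly_0_coeff_0\<close>)

lemma level3_expansion:
  assumes "pulls_back 3 2 r 27 6 0 N D" "coeff N 0 = 0" "coeff D 0 = 1"
    and "\<And>p. poly N p = n p" "\<And>p. poly D p = d p"
  shows "(\<lambda>p. 1 / d p * f3 (n p / d p ^ 3)) has_fps_expansion common_fps"
  unfolding assms(4,5)[symmetric] f3_eq
  by (rule pullback_has_fps_expansion[OF assms(1-3)])
     (use assms(3) in \<open>auto intro!: analytic_intros poly_analytic simp: poly_0_coeff_0\<close>)

lemma level4_expansion:
  assumes "pulls_back 1 1 r 16 4 0 N D" "coeff N 0 = 0" "coeff D 0 = 1"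
    and "\<And>p. poly N p = n p" "\<And>p. poly D p = d p"
    and "\<omega> analytic_on {0}" "\<omega> 0 = 1" "\<And>p. \<omega> p ^ 2 = d p"
  shows "(\<lambda>p. 1 / \<omega> p * f4 (n p / d p)) has_fps_expansion common_fps"
  using pullback_has_fps_expansion[OF assms(1-3) assms(6,7)]
  by (simp add: assms(4,5,8) f4_eq)

lemma level6_expansion:
  assumes "pulls_back 1 2 r \<alpha> \<beta> \<gamma> N D" "coeff N 0 = 0" "coeff D 0 = 1"
    and "\<And>p. poly N p = n p" "\<And>p. poly D p = d p"
  shows "(\<lambda>p. 1 / d p * apery_fun \<alpha> \<beta> \<gamma> (n p / d p)) has_fps_expansion common_fps"
proof -
  have "(\<lambda>p. 1 / poly D p * apery_fun \<alpha> \<beta> \<gamma> (poly N p / poly D p ^ 1)) has_fps_expansion common_fps"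
    by (rule pullback_has_fps_expansion[OF assms(1-3)])
       (use assms(3) in \<open>auto intro!: analytic_intros poly_analytic simp: poly_0_coeff_0\<close>)
  then show ?thesis by (simp add: assms(4,5))
qed

lemma eventually_all_equal:
  fixes Fs :: "(complex \<Rightarrow> complex) list"
  assumes "list_all (\<lambda>F. F has_fps_expansion Y) Fs"
  shows "\<forall>\<^sub>F p in nhds 0. \<forall>F \<in> set Fs. \<forall>G \<in> set Fs. F p = G p"
proof -
  have "\<forall>\<^sub>F p in nhds 0. \<forall>F \<in> set Fs. F p = eval_fps Y p"
    using assms by (auto simp: eventually_ball_finite_distrib has_fps_expansion_def list_all_iff eq_commute)
  then show ?thesis by eventually_elim metis
qed

theorem theorem4p1:
  shows "let functions = [
    \<comment> \<open>Level 2\<close>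
    \<lambda>p. 1 / (1 + 20*p - 48*p^2 + 32*p^3 - 32*p^4) powr (1/2)
         * f2 (p * (1-p)^3 * (1-2*p) * (1+2*p)^3 / (1 + 20*p - 48*p^2 + 32*p^3 - 32*p^4)^2),
    \<lambda>p. 1 / (1 - 4*p + 24*p^2 - 40*p^3 - 8*p^4) powr (1/2)
         * f2 (p^2 * (1-p)^6 / (1 - 4*p + 24*p^2 - 40*p^3 - 8*p^4)^2),
    \<lambda>p. 1 / (1 - 4*p + 32*p^3 - 32*p^4) powr (1/2)
         * f2 (p^3 * (1-p) * (1-2*p)^3 * (1+2*p) / (1 - 4*p + 32*p^3 - 32*p^4)^2),
    \<lambda>p. 1 / (1 - 4*p + 8*p^3 - 8*p^4) powr (1/2)
         * f2 (p^6 * (1-p)^2 / (1 - 4*p + 8*p^3 - 8*p^4)^2),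
    \<lambda>p. 1 / (1 - 28*p + 96*p^2 - 112*p^3 + 16*p^4) powr (1/2)
         * f2 (- p * (1-p)^3 * (1-4*p)^3 / (1 - 28*p + 96*p^2 - 112*p^3 + 16*p^4)^2),
    \<lambda>p. 1 / (1 - 4*p - 16*p^3 + 16*p^4) powr (1/2)
         * f2 (- (p^3) * (1-p) * (1-4*p) / (1 - 4*p - 16*p^3 + 16*p^4)^2),
    \<comment> \<open>Level 3\<close>
    \<lambda>p. 1 / (1 + 4*p - 8*p^2) * f3 (p * (1-2*p) / (1 + 4*p - 8*p^2)^3),
    \<lambda>p. 1 / (1 - 2*p + 4*p^2) * f3 (p^2 * (1-2*p)^2 / (1 - 2*p + 4*p^2)^3),
    \<lambda>p. 1 / (1 - 2*p - 2*p^2) * f3 (p^4 * (1-2*p) / (1 - 2*p - 2*p^2)^3),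
    \<lambda>p. 1 / (1 - 8*p + 4*p^2) * f3 (- p * (1-2*p)^4 / (1 - 8*p + 4*p^2)^3),
    \<comment> \<open>Level 4\<close>
    \<lambda>p. 1 / ((1-2*p) powr (1/2) * (1+2*p) powr (3/2))
         * f4 (p * (1-p)^3 / ((1-2*p) * (1+2*p)^3)),
    \<lambda>p. 1 / ((1-2*p) powr (3/2) * (1+2*p) powr (1/2))
         * f4 (p^3 * (1-p) / ((1-2*p)^3 * (1+2*p))),
    \<lambda>p. 1 / (1-4*p) powr (3/2) * f4 (- p * (1-p)^3 / (1-4*p)^3),
    \<lambda>p. 1 / (1-4*p) powr (1/2) * f4 (- (p^3) * (1-p) / (1-4*p)),
    \<comment> \<open>Level 6\<close>
    \<lambda>p. 1 / (1-4*p)^2 * f6a (p * (1-2*p) / (1-4*p)^2),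
    \<lambda>p. 1 / ((1-4*p) * (1+2*p)) * f6a (p^2 / ((1-4*p) * (1+2*p))),
    \<lambda>p. 1 / (1+2*p)^2 * f6a (- p / (1+2*p)^2),
    \<lambda>p. 1 / ((1-p) * (1+2*p)) * f6b (p * (1-2*p) / ((1-p) * (1+2*p))),
    \<lambda>p. 1 / (1-p)^2 * f6b (p^2 / (1-p)^2),
    \<lambda>p. 1 / ((1-p) * (1-4*p)) * f6b (- p / ((1-p) * (1-4*p))),
    \<lambda>p. f6c (p * (1-2*p)),
    \<lambda>p. 1 / (1-2*p) * f6c (p^2 / (1-2*p)),
    \<lambda>p. 1 / (1-2*p)^2 * f6c (- p / (1-2*p)^2)]
  in \<forall>\<^sub>F p in nhds (0::complex). \<forall>F \<in> set functions. \<forall>G \<in> set functions. F p = G p"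
  unfolding Let_def
proof (rule eventually_all_equal[where Y = common_fps], unfold list.pred_inject, intro conjI)
  show "(\<lambda>p. 1 / (1 + 20*p - 48*p^2 + 32*p^3 - 32*p^4) powr (1/2)
          * f2 (p * (1-p)^3 * (1-2*p) * (1+2*p)^3 / (1 + 20*p - 48*p^2 + 32*p^3 - 32*p^4)^2))
      has_fps_expansion common_fps"
    by (rule level2_expansion[where r = 1
          and N = "[:0, 1:] * [:1, -1:] ^ 3 * [:1, -2:] * [:1, 2:] ^ 3"
          and D = "[:1, 20, -48, 32, -32:]"])
       (simp_all add: pulls_back_eval algebra_simps)
  show "(\<lambda>p. 1 / (1 - 4*p + 24*p^2 - 40*p^3 - 8*p^4) powr (1/2)
          * f2 (p^2 * (1-p)^6 / (1 - 4*p + 24*p^2 - 40*p^3 - 8*p^4)^2))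
      has_fps_expansion common_fps"
    by (rule level2_expansion[where r = 2
          and N = "[:0, 1:] ^ 2 * [:1, -1:] ^ 6"
          and D = "[:1, -4, 24, -40, -8:]"])
       (simp_all add: pulls_back_eval algebra_simps)
  show "(\<lambda>p. 1 / (1 - 4*p + 32*p^3 - 32*p^4) powr (1/2)
          * f2 (p^3 * (1-p) * (1-2*p)^3 * (1+2*p) / (1 - 4*p + 32*p^3 - 32*p^4)^2))
      has_fps_expansion common_fps"
    by (rule level2_expansion[where r = 3
          and N = "[:0, 1:] ^ 3 * [:1, -1:] * [:1, -2:] ^ 3 * [:1, 2:]"
          and D = "[:1, -4, 0, 32, -32:]"])
       (simp_all add: pulls_back_eval algebra_simps)
  show "(\<lambda>p. 1 / (1 - 4*p + 8*p^3 - 8*p^4) powr (1/2)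
          * f2 (p^6 * (1-p)^2 / (1 - 4*p + 8*p^3 - 8*p^4)^2))
      has_fps_expansion common_fps"
    by (rule level2_expansion[where r = 6
          and N = "[:0, 1:] ^ 6 * [:1, -1:] ^ 2"
          and D = "[:1, -4, 0, 8, -8:]"])
       (simp_all add: pulls_back_eval algebra_simps)
  show "(\<lambda>p. 1 / (1 - 28*p + 96*p^2 - 112*p^3 + 16*p^4) powr (1/2)
          * f2 (- p * (1-p)^3 * (1-4*p)^3 / (1 - 28*p + 96*p^2 - 112*p^3 + 16*p^4)^2))
      has_fps_expansion common_fps"
    by (rule level2_expansion[where r = 1
          and N = "- ([:0, 1:] * [:1, -1:] ^ 3 * [:1, -4:] ^ 3)"
          and D = "[:1, -28, 96, -112, 16:]"])
       (simp_all add: pulls_back_eval algebra_simps)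
  show "(\<lambda>p. 1 / (1 - 4*p - 16*p^3 + 16*p^4) powr (1/2)
          * f2 (- (p^3) * (1-p) * (1-4*p) / (1 - 4*p - 16*p^3 + 16*p^4)^2))
      has_fps_expansion common_fps"
    by (rule level2_expansion[where r = 3
          and N = "- ([:0, 1:] ^ 3 * [:1, -1:] * [:1, -4:])"
          and D = "[:1, -4, 0, -16, 16:]"])
       (simp_all add: pulls_back_eval algebra_simps)
  show "(\<lambda>p. 1 / (1 + 4*p - 8*p^2)
          * f3 (p * (1-2*p) / (1 + 4*p - 8*p^2)^3))
      has_fps_expansion common_fps"
    by (rule level3_expansion[where r = 1
          and N = "[:0, 1:] * [:1, -2:]"
          and D = "[:1, 4, -8:]"])
       (simp_all add: pulls_back_eval algebra_simps)
  show "(\<lambda>p. 1 / (1 - 2*p + 4*p^2)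
          * f3 (p^2 * (1-2*p)^2 / (1 - 2*p + 4*p^2)^3))
      has_fps_expansion common_fps"
    by (rule level3_expansion[where r = 2
          and N = "[:0, 1:] ^ 2 * [:1, -2:] ^ 2"
          and D = "[:1, -2, 4:]"])
       (simp_all add: pulls_back_eval algebra_simps)
  show "(\<lambda>p. 1 / (1 - 2*p - 2*p^2)
          * f3 (p^4 * (1-2*p) / (1 - 2*p - 2*p^2)^3))
      has_fps_expansion common_fps"
    by (rule level3_expansion[where r = 4
          and N = "[:0, 1:] ^ 4 * [:1, -2:]"
          and D = "[:1, -2, -2:]"])
       (simp_all add: pulls_back_eval algebra_simps)
  show "(\<lambda>p. 1 / (1 - 8*p + 4*p^2)
          * f3 (- p * (1-2*p)^4 / (1 - 8*p + 4*p^2)^3))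
      has_fps_expansion common_fps"
    by (rule level3_expansion[where r = 1
          and N = "- ([:0, 1:] * [:1, -2:] ^ 4)"
          and D = "[:1, -8, 4:]"])
       (simp_all add: pulls_back_eval algebra_simps)
  show "(\<lambda>p. 1 / ((1-2*p) powr (1/2) * (1+2*p) powr (3/2))
          * f4 (p * (1-p)^3 / ((1-2*p) * (1+2*p)^3)))
      has_fps_expansion common_fps"
    by (rule level4_expansion[where r = 1
          and N = "[:0, 1:] * [:1, -1:] ^ 3"
          and D = "[:1, -2:] * [:1, 2:] ^ 3"],
        unfold power_mult_distrib powr_half_integer_sq)
       (auto intro!: analytic_intros simp: pulls_back_eval algebra_simps)
  show "(\<lambda>p. 1 / ((1-2*p) powr (3/2) * (1+2*p) powr (1/2))
          * f4 (p^3 * (1-p) / ((1-2*p)^3 * (1+2*p))))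
      has_fps_expansion common_fps"
    by (rule level4_expansion[where r = 3
          and N = "[:0, 1:] ^ 3 * [:1, -1:]"
          and D = "[:1, -2:] ^ 3 * [:1, 2:]"],
        unfold power_mult_distrib powr_half_integer_sq)
       (auto intro!: analytic_intros simp: pulls_back_eval algebra_simps)
  show "(\<lambda>p. 1 / (1-4*p) powr (3/2)
          * f4 (- p * (1-p)^3 / (1-4*p)^3))
      has_fps_expansion common_fps"
    by (rule level4_expansion[where r = 1
          and N = "- ([:0, 1:] * [:1, -1:] ^ 3)"
          and D = "[:1, -4:] ^ 3"],
        unfold power_mult_distrib powr_half_integer_sq)
       (auto intro!: analytic_intros simp: pulls_back_eval algebra_simps)
  show "(\<lambda>p. 1 / (1-4*p) powr (1/2)
          * f4 (- (p^3) * (1-p) / (1-4*p)))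
      has_fps_expansion common_fps"
    by (rule level4_expansion[where r = 3
          and N = "- ([:0, 1:] ^ 3 * [:1, -1:])"
          and D = "[:1, -4:]"],
        unfold power_mult_distrib powr_half_integer_sq)
       (auto intro!: analytic_intros simp: pulls_back_eval algebra_simps)
  show "(\<lambda>p. 1 / (1-4*p)^2 * f6a (p * (1-2*p) / (1-4*p)^2)) has_fps_expansion common_fps"
    unfolding f6a_def
    by (rule level6_expansion[where r = 1 and N = "[:0, 1:] * [:1, -2:]" and D = "[:1, -4:] ^ 2"])
       (simp_all add: pulls_back_eval algebra_simps)
  show "(\<lambda>p. 1 / ((1-4*p) * (1+2*p))
          * f6a (p^2 / ((1-4*p) * (1+2*p))))
      has_fps_expansion common_fps"
    unfolding f6a_def
    by (rule level6_expansion[where r = 2 and N = "[:0, 1:] ^ 2" and D = "[:1, -4:] * [:1, 2:]"])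
       (simp_all add: pulls_back_eval algebra_simps)
  show "(\<lambda>p. 1 / (1+2*p)^2 * f6a (- p / (1+2*p)^2)) has_fps_expansion common_fps"
    unfolding f6a_def
    by (rule level6_expansion[where r = 1 and N = "- ([:0, 1:])" and D = "[:1, 2:] ^ 2"])
       (simp_all add: pulls_back_eval algebra_simps)
  show "(\<lambda>p. 1 / ((1-p) * (1+2*p))
          * f6b (p * (1-2*p) / ((1-p) * (1+2*p))))
      has_fps_expansion common_fps"
    unfolding f6b_def
    by (rule level6_expansion[where r = 1 and N = "[:0, 1:] * [:1, -2:]" and D = "[:1, -1:] * [:1, 2:]"])
       (simp_all add: pulls_back_eval algebra_simps)
  show "(\<lambda>p. 1 / (1-p)^2 * f6b (p^2 / (1-p)^2)) has_fps_expansion common_fps"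
    unfolding f6b_def
    by (rule level6_expansion[where r = 2 and N = "[:0, 1:] ^ 2" and D = "[:1, -1:] ^ 2"])
       (simp_all add: pulls_back_eval algebra_simps)
  show "(\<lambda>p. 1 / ((1-p) * (1-4*p))
          * f6b (- p / ((1-p) * (1-4*p))))
      has_fps_expansion common_fps"
    unfolding f6b_def
    by (rule level6_expansion[where r = 1 and N = "- ([:0, 1:])" and D = "[:1, -1:] * [:1, -4:]"])
       (simp_all add: pulls_back_eval algebra_simps)
  show "(\<lambda>p. f6c (p * (1-2*p))) has_fps_expansion common_fps"
    using level6_expansion[where r = 1 and N = "[:0, 1:] * [:1, -2:]" and D = "1" and n = "\<lambda>p. p * (1-2*p)" and d = "\<lambda>_. 1" and \<alpha> = 7 and \<beta> = 2 and \<gamma> = 8]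
    by (simp add: f6c_def pulls_back_eval algebra_simps)
  show "(\<lambda>p. 1 / (1-2*p) * f6c (p^2 / (1-2*p))) has_fps_expansion common_fps"
    unfolding f6c_def
    by (rule level6_expansion[where r = 2 and N = "[:0, 1:] ^ 2" and D = "[:1, -2:]"])
       (simp_all add: pulls_back_eval algebra_simps)
  show "(\<lambda>p. 1 / (1-2*p)^2 * f6c (- p / (1-2*p)^2)) has_fps_expansion common_fps"
    unfolding f6c_def
    by (rule level6_expansion[where r = 1 and N = "- ([:0, 1:])" and D = "[:1, -2:] ^ 2"])
       (simp_all add: pulls_back_eval algebra_simps)
qed simp

end
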